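(* Let $u$ be the smooth unique solution of the Poisson problem with mixed boundary conditions described in the context, let $\hat u:\hat\Omega\to\mathbb{R}$ be the smooth extension of $u$ described there, and let $u_h$ be the unfitted RBF-FD least-squares solution with interpolation points $X$, $M$ evaluation points $Y$ and polynomial degree $p$. Assume that the discrete PDE matrix $D_h=D_h(Y,X)$ has full column rank. Then $$\|u(Y)-u_h(Y)\|_{\ell_2}\;\le\;\frac{1}{\sqrt{M}}\,\|E_h\|_2\,\|D_h^+\|_2\,C_D\,h^{p-1}\,\max|D^{p+1}\hat u|\;+\;C_E\,h^{p+1}\,\max|D^{p+1}\hat u|,$$ where $E_h=E_h(Y,X)$ is the evaluation matrix, $D_h^+=(D_h^TD_h)^{-1}D_h^T$, $\|\cdot\|_2$ on matrices is the norm induced by the Euclidean norm, $\max|D^{p+1}\hat u|$ is the seminorm $|\hat u|_{W^{p+1}_\infty}$ of the context, and $C_D$, $C_E$ are the constants coming from, respectively, the consistency estimate for the PDE operator and the interpolation estimate recalled in the context.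
   Context: **Model problem.** $\Omega\subset\mathbb{R}^d$ ($d=2,3$) is open and bounded with smooth boundary $\partial\Omega$, of which $\partial\Omega_0$ and $\partial\Omega_1$ are two disjoint parts; $n(y)$ is the outward normal. $u$ is smooth and is the unique solution of $\Delta u=f_2$ in $\Omega$, $u=f_0$ on $\partial\Omega_0$, $\nabla u\cdot n=f_1$ on $\partial\Omega_1$. This is written $Du(y)=F(y)$, where $Du(y)$ is $\Delta u(y)$ for $y\in\Omega$, $u(y)$ for $y\in\partial\Omega_0$, $\nabla u(y)\cdot n(y)$ for $y\in\partial\Omega_1$, and $F(y)$ is correspondingly $f_2(y)$, $f_0(y)$, $f_1(y)$. **Points.** $X=\{x_i\}_{i=1}^N$ are interpolation points that need not conform to $\Omega$ (some lie outside $\bar\Omega$). $Y=\{y_k\}_{k=1}^M\subset\bar\Omega$ are evaluation points conforming to $\Omega$, of which $M_2$ lie in $\Omega$, $M_0$ on $\partial\Omega_0$ and $M_1$ on $\partial\Omega_1$. $h$ denotes the node distance of $X$ (the average node distance in the scalings below, and the fill distance in the approximation estimates below). **Extension.** $\hat\Omega\subset\mathbb{R}^d$ is an extended open domain containing $\bar\Omega$ and the points $X$. $\hat u:\hat\Omega\to\mathbb{R}$ is smooth with $\hat u|_{\bar\Omega}=u$; such an extension exists by the extension lemma for smooth functions on closed sets. $|\hat u|_{W_\infty^{p+1}}=\max_{y\in\hat\Omega}|\mathcal D^{p+1}\hat u(y)|$, where $\mathcal D^{p+1}$ is a partial derivative of degree $p+1$. **Stencils and cardinal functions.** For each $i=1,\dots,N$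 a stencil consists of $n$ points $x_{\Gamma(1,i)},\dots,x_{\Gamma(n,i)}$ of $X$, including the center $x_i$; $\Gamma(j,i)\in\{1,\dots,N\}$ is the global index of the $j$-th stencil point. Let $\phi_l^{(i)}(z)=\|z-x_{\Gamma(l,i)}\|^3$ (Euclidean norm), $l=1,\dots,n$, and let $\bar p_1,\dots,\bar p_m$ be the monomials in $d$ variables of degree at most $p$, $m=\binom{p+d}{d}$. Let $A^{(i)}_{jl}=\phi^{(i)}_l(x_{\Gamma(j,i)})$, $P^{(i)}_{jk}=\bar p_k(x_{\Gamma(j,i)})$, let $$\tilde A^{(i)}=\begin{pmatrix}A^{(i)}&P^{(i)}\\(P^{(i)})^T&0\end{pmatrix}$$ (which the method inverts), and let $b^{(i)}(z)=(\phi^{(i)}_1(z),\dots,\phi^{(i)}_n(z),\bar p_1(z),\dots,\bar p_m(z))$. For a point $y$ let $\rho(y)=\arg\min_i\|y-x_i\|$. The global cardinal functions, and a differential operator $\mathcal L$ applied to them, are $$\Psi_i(y)=\sum_{j=1}^n\left[b^{(\rho(y))}(y)\,(\tilde A^{(\rho(y))})^{-1}\right]_j\delta_{i,\Gamma(j,\rho(y))},\qquad \mathcal L\Psi_i(y)=\sum_{j=1}^n\left[\mathcal L b^{(\rho(y))}(y)\,(\tilde A^{(\rho(y))})^{-1}\right]_j\delta_{i,\Gamma(j,\rho(y))},$$ derivatives being taken within the stencil with index $\rho(y)$. **Discretization.** $E_h\in\mathbb{R}^{M\times N}$ has entries $(E_h)_{ki}=\Psi_i(y_k)$. Let $\beta_2=M_2^{-1/2}$,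 $\beta_0=h^{-1}M_0^{-1/2}$, $\beta_1=M_1^{-1/2}$. The matrix $D_h(Y,X)\in\mathbb{R}^{M\times N}$ and the discrete right-hand side $F(Y)\in\mathbb{R}^M$ have $k$-th row/entry: $(D_h)_{ki}=\beta_2\Delta\Psi_i(y_k)$, $F_k=\beta_2f_2(y_k)$ if $y_k\in\Omega$; $(D_h)_{ki}=\beta_0\Psi_i(y_k)$, $F_k=\beta_0f_0(y_k)$ if $y_k\in\partial\Omega_0$; $(D_h)_{ki}=\beta_1\nabla\Psi_i(y_k)\cdot n(y_k)$, $F_k=\beta_1f_1(y_k)$ if $y_k\in\partial\Omega_1$. The numerical solution is the least-squares solution $u_h(X)=D_h^+F(Y)$ of $D_hu_h(X)=F(Y)$, evaluated at $Y$ by $u_h(Y)=E_hu_h(X)=E_hD_h^+F(Y)$. **Norm.** For $e\in\mathbb{R}^M$, $\|e\|_{\ell_2}^2=\frac1M\sum_{k=1}^Me_k^2$; $u(Y)$ denotes the vector $(u(y_k))_{k=1}^M$. **Approximation estimates (known results for RBF-FD).** Let $u_{\mathrm{ext}}(y)=\sum_{i=1}^N\hat u(x_i)\Psi_i(y)$ and $Du_{\mathrm{ext}}(y)=\sum_{i=1}^N\hat u(x_i)D\Psi_i(y)$. The interpolation error satisfies $$\|\hat u-u_{\mathrm{ext}}\|_\infty\le C_Ih^{p+1}|\hat u|_{W^{p+1}_\infty},$$ where $C_I$ depends on $p$ and on the quality $c_q=h/h_s$ of $X$, with fill distance $h=\sup_{x\in\Omega}\min_{x_j\in X}\|x-x_j\|_2$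 and separation distance $h_s=\frac12\min_{j\ne k}\|x_j-x_k\|_2$. The overall consistency error of the PDE operator $D$ (Laplacian, normal derivative and Dirichlet parts together) satisfies $$\|D\hat u-Du_{\mathrm{ext}}\|_\infty\le\left(C_2h^{p-1}+C_1h^p+C_0h^{p+1}\right)|\hat u|_{W^{p+1}_\infty}\le C\,h^{p-1}|\hat u|_{W^{p+1}_\infty}.$$ **Terminology.** The factor $\frac{1}{\sqrt M}\|E_h\|_2\|D_h^+\|_2$ is called the stability norm; no a priori bound on it is part of the estimate. *)

theory Defs
  imports "HOL-Analysis.Analysis"
begin

section \<open>Partial derivatives and smoothness\<close>

definition partial_deriv :: "'d \<Rightarrow> (real^'d::finite \<Rightarrow> real) \<Rightarrow> real^'d \<Rightarrow> real" where
  "partial_deriv i f = (\<lambda>x. frechet_derivative f (at x) (axis i 1))"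

primrec partial_derivs :: "'d list \<Rightarrow> (real^'d::finite \<Rightarrow> real) \<Rightarrow> real^'d \<Rightarrow> real" where
  "partial_derivs [] f = f"
| "partial_derivs (i # is) f = partial_deriv i (partial_derivs is f)"

definition grad :: "(real^'d::finite \<Rightarrow> real) \<Rightarrow> real^'d \<Rightarrow> real^'d" where
  "grad f x = (\<chi> i. partial_deriv i f x)"

definition laplacian :: "(real^'d::finite \<Rightarrow> real) \<Rightarrow> real^'d \<Rightarrow> real" where
  "laplacian f x = (\<Sum>i\<in>UNIV. partial_deriv i (partial_deriv i f) x)"

text \<open>Differentiability of the iterated partial derivatives of every order at every point also
  yields their continuity, so on an open set this is \<open>C\<^sup>\<infinity>\<close>.\<close>

definition smooth_on_open :: "(real^'d::finite) set \<Rightarrow> (real^'d \<Rightarrow> real) \<Rightarrow> bool" where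
  "smooth_on_open S f \<longleftrightarrow> open S \<and> (\<forall>is. \<forall>x\<in>S. partial_derivs is f differentiable (at x))"

text \<open>On a closed set, smooth means: restriction of a smooth function on an open neighbourhood.\<close>

definition smooth_on_closed :: "(real^'d::finite) set \<Rightarrow> (real^'d \<Rightarrow> real) \<Rightarrow> bool" where
  "smooth_on_closed S f \<longleftrightarrow> (\<exists>V g. S \<subseteq> V \<and> smooth_on_open V g \<and> (\<forall>x\<in>S. g x = f x))"

text \<open>The values whose maximum is \<open>|f|\<close> in \<open>W\<^sup>k\<^sub>\<infinity>(S)\<close>. Since \<open>S\<close> is open, the maximum is read as
  a supremum, which is meaningful when the set is bounded above.\<close>

definition deriv_values :: "nat \<Rightarrow> (real^'d::finite) set \<Rightarrow> (real^'d \<Rightarrow> real) \<Rightarrow> real set" where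
  "deriv_values k S f = {\<bar>partial_derivs is f y\<bar> | is y. length is = k \<and> y \<in> S}"

definition sobolev_seminorm :: "nat \<Rightarrow> (real^'d::finite) set \<Rightarrow> (real^'d \<Rightarrow> real) \<Rightarrow> real" where
  "sobolev_seminorm k S f = Sup (deriv_values k S f)"


section \<open>The mixed boundary value problem\<close>

definition local_defining_function ::
  "(real^'d::finite) set \<Rightarrow> (real^'d) set \<Rightarrow> (real^'d \<Rightarrow> real) \<Rightarrow> bool" where
  "local_defining_function \<Omega> U r \<longleftrightarrow>
     smooth_on_open U r \<and> (\<forall>x\<in>U. grad r x \<noteq> 0) \<and> (\<forall>x\<in>U. x \<in> \<Omega> \<longleftrightarrow> r x < 0)"

definition smooth_boundary :: "(real^'d::finite) set \<Rightarrow> bool" where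
  "smooth_boundary \<Omega> \<longleftrightarrow> (\<forall>y\<in>frontier \<Omega>. \<exists>U r. y \<in> U \<and> local_defining_function \<Omega> U r)"

definition outward_normal :: "(real^'d::finite) set \<Rightarrow> (real^'d \<Rightarrow> real^'d) \<Rightarrow> bool" where
  "outward_normal \<Omega> \<nu> \<longleftrightarrow>
     (\<forall>y\<in>frontier \<Omega>. \<forall>U r. y \<in> U \<and> local_defining_function \<Omega> U r \<longrightarrow> \<nu> y = sgn (grad r y))"

text \<open>\<open>\<Omega>\<^sub>0\<close> and \<open>\<Omega>\<^sub>1\<close> are the Dirichlet and the Neumann part of the boundary.\<close>

definition problem_domain ::
  "(real^'d::finite) set \<Rightarrow> (real^'d) set \<Rightarrow> (real^'d) set \<Rightarrow> (real^'d \<Rightarrow> real^'d) \<Rightarrow> bool" where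
  "problem_domain \<Omega> \<Omega>\<^sub>0 \<Omega>\<^sub>1 \<nu> \<longleftrightarrow>
     open \<Omega> \<and> bounded \<Omega> \<and> smooth_boundary \<Omega> \<and> outward_normal \<Omega> \<nu> \<and>
     \<Omega>\<^sub>0 \<subseteq> frontier \<Omega> \<and> \<Omega>\<^sub>1 \<subseteq> frontier \<Omega> \<and> \<Omega>\<^sub>0 \<inter> \<Omega>\<^sub>1 = {}"

text \<open>A function \<open>v\<close> on the closed domain has meaningful values only there, so its gradient at a
  boundary point is taken within \<open>closure \<Omega>\<close>.\<close>

definition smooth_solution ::
  "(real^'d::finite) set \<Rightarrow> (real^'d) set \<Rightarrow> (real^'d) set \<Rightarrow> (real^'d \<Rightarrow> real^'d) \<Rightarrow>
   (real^'d \<Rightarrow> real) \<Rightarrow> (real^'d \<Rightarrow> real) \<Rightarrow> (real^'d \<Rightarrow> real) \<Rightarrow> (real^'d \<Rightarrow> real) \<Rightarrow> bool" where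
  "smooth_solution \<Omega> \<Omega>\<^sub>0 \<Omega>\<^sub>1 \<nu> f\<^sub>2 f\<^sub>0 f\<^sub>1 v \<longleftrightarrow>
     smooth_on_closed (closure \<Omega>) v \<and>
     (\<forall>y\<in>\<Omega>. laplacian v y = f\<^sub>2 y) \<and>
     (\<forall>y\<in>\<Omega>\<^sub>0. v y = f\<^sub>0 y) \<and>
     (\<forall>y\<in>\<Omega>\<^sub>1. frechet_derivative v (at y within closure \<Omega>) (\<nu> y) = f\<^sub>1 y)"

definition unique_smooth_solution ::
  "(real^'d::finite) set \<Rightarrow> (real^'d) set \<Rightarrow> (real^'d) set \<Rightarrow> (real^'d \<Rightarrow> real^'d) \<Rightarrow>
   (real^'d \<Rightarrow> real) \<Rightarrow> (real^'d \<Rightarrow> real) \<Rightarrow> (real^'d \<Rightarrow> real) \<Rightarrow> (real^'d \<Rightarrow> real) \<Rightarrow> bool" where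
  "unique_smooth_solution \<Omega> \<Omega>\<^sub>0 \<Omega>\<^sub>1 \<nu> f\<^sub>2 f\<^sub>0 f\<^sub>1 u \<longleftrightarrow>
     smooth_solution \<Omega> \<Omega>\<^sub>0 \<Omega>\<^sub>1 \<nu> f\<^sub>2 f\<^sub>0 f\<^sub>1 u \<and>
     (\<forall>v. smooth_solution \<Omega> \<Omega>\<^sub>0 \<Omega>\<^sub>1 \<nu> f\<^sub>2 f\<^sub>0 f\<^sub>1 v \<longrightarrow> (\<forall>y\<in>closure \<Omega>. v y = u y))"

definition smooth_extension ::
  "(real^'d::finite) set \<Rightarrow> (real^'d) set \<Rightarrow> (real^'d \<Rightarrow> real) \<Rightarrow> (real^'d \<Rightarrow> real) \<Rightarrow> bool" where
  "smooth_extension \<Omega> \<Omega>' u u' \<longleftrightarrow>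
     closure \<Omega> \<subseteq> \<Omega>' \<and> smooth_on_open \<Omega>' u' \<and> (\<forall>y\<in>closure \<Omega>. u' y = u y)"

text \<open>The operator \<open>D\<close> and the data \<open>F\<close>, meant for points of \<open>\<Omega> \<union> \<Omega>\<^sub>0 \<union> \<Omega>\<^sub>1\<close> only. \<open>D\<close> is applied to
  functions defined in a full neighbourhood of each point.\<close>

definition pde_operator ::
  "(real^'d::finite) set \<Rightarrow> (real^'d) set \<Rightarrow> (real^'d \<Rightarrow> real^'d) \<Rightarrow>
   (real^'d \<Rightarrow> real) \<Rightarrow> real^'d \<Rightarrow> real" where
  "pde_operator \<Omega> \<Omega>\<^sub>0 \<nu> f y =
     (if y \<in> \<Omega> then laplacian f y
      else if y \<in> \<Omega>\<^sub>0 then f y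
      else grad f y \<bullet> \<nu> y)"

definition pde_data ::
  "(real^'d::finite) set \<Rightarrow> (real^'d) set \<Rightarrow>
   (real^'d \<Rightarrow> real) \<Rightarrow> (real^'d \<Rightarrow> real) \<Rightarrow> (real^'d \<Rightarrow> real) \<Rightarrow> real^'d \<Rightarrow> real" where
  "pde_data \<Omega> \<Omega>\<^sub>0 f\<^sub>2 f\<^sub>0 f\<^sub>1 y =
     (if y \<in> \<Omega> then f\<^sub>2 y else if y \<in> \<Omega>\<^sub>0 then f\<^sub>0 y else f\<^sub>1 y)"


section \<open>Node distances\<close>

definition fill_distance :: "(real^'d::finite) set \<Rightarrow> ('N::finite \<Rightarrow> real^'d) \<Rightarrow> real" where
  "fill_distance \<Omega> X = (SUP x\<in>\<Omega>. Min (range (\<lambda>j. norm (x - X j))))"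

definition separation_distance :: "('N::finite \<Rightarrow> real^'d::finite) \<Rightarrow> real" where
  "separation_distance X = 1/2 * Min {norm (X j - X k) | j k. j \<noteq> k}"

definition node_quality :: "(real^'d::finite) set \<Rightarrow> ('N::finite \<Rightarrow> real^'d) \<Rightarrow> real" where
  "node_quality \<Omega> X = fill_distance \<Omega> X / separation_distance X"

text \<open>The mean of the distances from the nodes to their nearest neighbours.\<close>

definition average_node_distance :: "('N::finite \<Rightarrow> real^'d::finite) \<Rightarrow> real" where
  "average_node_distance X =
     (\<Sum>i\<in>UNIV. Min {norm (X i - X j) | j. j \<noteq> i}) / real CARD('N)"


section \<open>Stencils and cardinal functions\<close>

text \<open>\<open>\<Gamma> j i\<close> is the global index of the \<open>j\<close>-th point of the stencil with center \<open>X i\<close>. The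
  monomials are enumerated by their exponents \<open>\<mu> :: 'm \<Rightarrow> 'd \<Rightarrow> nat\<close>, in any order.\<close>

definition is_stencil_map :: "('n::finite \<Rightarrow> 'N::finite \<Rightarrow> 'N) \<Rightarrow> bool" where
  "is_stencil_map \<Gamma> \<longleftrightarrow> (\<forall>i. inj (\<lambda>j. \<Gamma> j i) \<and> (\<exists>j. \<Gamma> j i = i))"

definition enumerates_monomials :: "nat \<Rightarrow> ('m::finite \<Rightarrow> 'd::finite \<Rightarrow> nat) \<Rightarrow> bool" where
  "enumerates_monomials p \<mu> \<longleftrightarrow> bij_betw \<mu> UNIV {\<alpha>. (\<Sum>k\<in>UNIV. \<alpha> k) \<le> p}"

definition monomial :: "('d::finite \<Rightarrow> nat) \<Rightarrow> real^'d \<Rightarrow> real" where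
  "monomial \<alpha> z = (\<Prod>k\<in>UNIV. (z $ k) ^ \<alpha> k)"

definition phs :: "('N::finite \<Rightarrow> real^'d::finite) \<Rightarrow> ('n::finite \<Rightarrow> 'N \<Rightarrow> 'N) \<Rightarrow> 'N \<Rightarrow> 'n \<Rightarrow>
   real^'d \<Rightarrow> real" where
  "phs X \<Gamma> i l z = norm (z - X (\<Gamma> l i)) ^ 3"

definition local_basis ::
  "('m::finite \<Rightarrow> 'd::finite \<Rightarrow> nat) \<Rightarrow> ('N::finite \<Rightarrow> real^'d) \<Rightarrow> ('n::finite \<Rightarrow> 'N \<Rightarrow> 'N) \<Rightarrow>
   'N \<Rightarrow> 'n + 'm \<Rightarrow> real^'d \<Rightarrow> real" where
  "local_basis \<mu> X \<Gamma> i a z = (case a of Inl l \<Rightarrow> phs X \<Gamma> i l z | Inr k \<Rightarrow> monomial (\<mu> k) z)"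

definition stencil_matrix ::
  "('m::finite \<Rightarrow> 'd::finite \<Rightarrow> nat) \<Rightarrow> ('N::finite \<Rightarrow> real^'d) \<Rightarrow> ('n::finite \<Rightarrow> 'N \<Rightarrow> 'N) \<Rightarrow>
   'N \<Rightarrow> real^('n + 'm)^('n + 'm)" where
  "stencil_matrix \<mu> X \<Gamma> i = (\<chi> a b.
     case a of
       Inl j \<Rightarrow> (case b of Inl l \<Rightarrow> phs X \<Gamma> i l (X (\<Gamma> j i))
                       | Inr k \<Rightarrow> monomial (\<mu> k) (X (\<Gamma> j i)))
     | Inr k \<Rightarrow> (case b of Inl l \<Rightarrow> monomial (\<mu> k) (X (\<Gamma> l i))
                       | Inr _ \<Rightarrow> 0))"

text \<open>\<open>\<rho> y\<close> is a nearest node to \<open>y\<close>; ties may be broken in any way.\<close>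

definition closest_node :: "('N::finite \<Rightarrow> real^'d::finite) \<Rightarrow> (real^'d \<Rightarrow> 'N) \<Rightarrow> bool" where
  "closest_node X \<rho> \<longleftrightarrow> (\<forall>y. is_arg_min (\<lambda>i. norm (y - X i)) (\<lambda>_. True) (\<rho> y))"

text \<open>\<open>cardinal L \<mu> X \<Gamma> \<rho> i y\<close> is \<open>L \<Psi>\<^sub>i(y)\<close>: the operator \<open>L\<close> acts on the basis of the fixed
  stencil \<open>\<rho> y\<close>, not on the piecewise defined function \<open>\<Psi>\<^sub>i\<close>. The function \<open>\<Psi>\<^sub>i\<close> itself is
  the case \<open>L = id\<close>.\<close>

definition cardinal ::
  "((real^'d::finite \<Rightarrow> real) \<Rightarrow> real^'d \<Rightarrow> real) \<Rightarrow>
   ('m::finite \<Rightarrow> 'd \<Rightarrow> nat) \<Rightarrow> ('N::finite \<Rightarrow> real^'d) \<Rightarrow> ('n::finite \<Rightarrow> 'N \<Rightarrow> 'N) \<Rightarrow>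
   (real^'d \<Rightarrow> 'N) \<Rightarrow> 'N \<Rightarrow> real^'d \<Rightarrow> real" where
  "cardinal L \<mu> X \<Gamma> \<rho> i y =
     (\<Sum>j\<in>UNIV. ((\<chi> a. L (local_basis \<mu> X \<Gamma> (\<rho> y) a) y)
                  v* matrix_inv (stencil_matrix \<mu> X \<Gamma> (\<rho> y))) $ Inl j
                * (if i = \<Gamma> j (\<rho> y) then 1 else 0))"

text \<open>\<open>L u\<^sub>e\<^sub>x\<^sub>t(y)\<close>, with \<open>w\<close> the extended function.\<close>

definition cardinal_sum ::
  "((real^'d::finite \<Rightarrow> real) \<Rightarrow> real^'d \<Rightarrow> real) \<Rightarrow>
   ('m::finite \<Rightarrow> 'd \<Rightarrow> nat) \<Rightarrow> ('N::finite \<Rightarrow> real^'d) \<Rightarrow> ('n::finite \<Rightarrow> 'N \<Rightarrow> 'N) \<Rightarrow>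
   (real^'d \<Rightarrow> 'N) \<Rightarrow> (real^'d \<Rightarrow> real) \<Rightarrow> real^'d \<Rightarrow> real" where
  "cardinal_sum L \<mu> X \<Gamma> \<rho> w y = (\<Sum>i\<in>UNIV. w (X i) * cardinal L \<mu> X \<Gamma> \<rho> i y)"


section \<open>Discretization\<close>

definition row_weight ::
  "(real^'d::finite) set \<Rightarrow> (real^'d) set \<Rightarrow> (real^'d) set \<Rightarrow> real \<Rightarrow> ('M::finite \<Rightarrow> real^'d) \<Rightarrow>
   real^'d \<Rightarrow> real" where
  "row_weight \<Omega> \<Omega>\<^sub>0 \<Omega>\<^sub>1 h Y y =
     (if y \<in> \<Omega> then 1 / sqrt (real (card {k. Y k \<in> \<Omega>}))
      else if y \<in> \<Omega>\<^sub>0 then 1 / (h * sqrt (real (card {k. Y k \<in> \<Omega>\<^sub>0})))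
      else 1 / sqrt (real (card {k. Y k \<in> \<Omega>\<^sub>1})))"

definition evaluation_matrix ::
  "('m::finite \<Rightarrow> 'd::finite \<Rightarrow> nat) \<Rightarrow> ('N::finite \<Rightarrow> real^'d) \<Rightarrow> ('n::finite \<Rightarrow> 'N \<Rightarrow> 'N) \<Rightarrow>
   (real^'d \<Rightarrow> 'N) \<Rightarrow> ('M::finite \<Rightarrow> real^'d) \<Rightarrow> real^'N^'M" where
  "evaluation_matrix \<mu> X \<Gamma> \<rho> Y = (\<chi> k i. cardinal id \<mu> X \<Gamma> \<rho> i (Y k))"

definition pde_matrix ::
  "(real^'d::finite) set \<Rightarrow> (real^'d) set \<Rightarrow> (real^'d) set \<Rightarrow> (real^'d \<Rightarrow> real^'d) \<Rightarrow>
   ('m::finite \<Rightarrow> 'd \<Rightarrow> nat) \<Rightarrow> ('N::finite \<Rightarrow> real^'d) \<Rightarrow> ('n::finite \<Rightarrow> 'N \<Rightarrow> 'N) \<Rightarrow>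
   (real^'d \<Rightarrow> 'N) \<Rightarrow> ('M::finite \<Rightarrow> real^'d) \<Rightarrow> real^'N^'M" where
  "pde_matrix \<Omega> \<Omega>\<^sub>0 \<Omega>\<^sub>1 \<nu> \<mu> X \<Gamma> \<rho> Y =
     (\<chi> k i. row_weight \<Omega> \<Omega>\<^sub>0 \<Omega>\<^sub>1 (average_node_distance X) Y (Y k)
             * cardinal (pde_operator \<Omega> \<Omega>\<^sub>0 \<nu>) \<mu> X \<Gamma> \<rho> i (Y k))"

definition pde_rhs ::
  "(real^'d::finite) set \<Rightarrow> (real^'d) set \<Rightarrow> (real^'d) set \<Rightarrow>
   (real^'d \<Rightarrow> real) \<Rightarrow> (real^'d \<Rightarrow> real) \<Rightarrow> (real^'d \<Rightarrow> real) \<Rightarrow>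
   ('N::finite \<Rightarrow> real^'d) \<Rightarrow> ('M::finite \<Rightarrow> real^'d) \<Rightarrow> real^'M" where
  "pde_rhs \<Omega> \<Omega>\<^sub>0 \<Omega>\<^sub>1 f\<^sub>2 f\<^sub>0 f\<^sub>1 X Y =
     (\<chi> k. row_weight \<Omega> \<Omega>\<^sub>0 \<Omega>\<^sub>1 (average_node_distance X) Y (Y k)
           * pde_data \<Omega> \<Omega>\<^sub>0 f\<^sub>2 f\<^sub>0 f\<^sub>1 (Y k))"

text \<open>The pseudoinverse of a matrix of full column rank.\<close>

definition pseudoinverse :: "real^'N::finite^'M::finite \<Rightarrow> real^'M^'N" where
  "pseudoinverse A = matrix_inv (transpose A ** A) ** transpose A"

abbreviation matrix_norm2 :: "real^'N::finite^'M::finite \<Rightarrow> real" where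
  "matrix_norm2 A \<equiv> onorm ((*v) A)"

definition l2_norm :: "real^'M::finite \<Rightarrow> real" where
  "l2_norm e = sqrt (1 / real CARD('M) * (\<Sum>k\<in>UNIV. (e $ k)\<^sup>2))"

text \<open>The constant \<open>C\<^sub>D\<close>, in terms of the node quality \<open>q\<close> and of the constants of the interpolation
  estimate (\<open>C\<^sub>I\<close>) and of the two-step consistency estimate (\<open>C\<^sub>0\<close>, \<open>C\<close>). After scaling, the Laplace
  and the Neumann rows contribute at most \<open>C h\<^sup>p\<^sup>-\<^sup>1\<close> each. In the Dirichlet rows, where the
  consistency error is the interpolation error, the weight (the reciprocal of the average node
  distance, at most \<open>q / h\<close>) leaves \<open>q C\<^sub>I h\<^sup>p\<close>, and \<open>C\<^sub>0 h\<^sup>p\<^sup>+\<^sup>1 \<le> C h\<^sup>p\<^sup>-\<^sup>1\<close> bounds the extra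
  factor \<open>h\<close> by \<open>sqrt (C / C\<^sub>0)\<close>.\<close>

definition consistency_constant :: "real \<Rightarrow> real \<Rightarrow> real \<Rightarrow> real \<Rightarrow> real" where
  "consistency_constant q C\<^sub>I C\<^sub>0 C = sqrt 2 * C + q * C\<^sub>I * sqrt (C / C\<^sub>0)"

end

theory Submission
  imports Defs
begin

text \<open>
  Let \<open>w\<close> be the vector of nodal values of the extension \<open>u'\<close>, \<open>A\<close> the weighted matrix of the
  differential operator, \<open>b\<close> its right-hand side, \<open>E\<close> the evaluation matrix and \<open>A\<^sup>+\<close> the
  pseudoinverse. Full column rank means \<open>A\<^sup>+ A = 1\<close>, so the error splits as
  \<open>u(Y) - E A\<^sup>+ b = (u(Y) - E w) + E A\<^sup>+ (A w - b)\<close>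
  (lemma \<open>least_squares_error_bound\<close>). The first part is the interpolation error at \<open>Y\<close>, and
  \<open>l2_norm\<close> is a mean square, so the pointwise interpolation estimate bounds it without any
  dependence on the number of points.

  The second part needs a bound on the residual \<open>A w - b\<close> that is independent of that number too.
  Its entries are weighted consistency errors, provided the operator maps \<open>u'\<close> to the data
  (lemma \<open>pde_operator_extension_eq_data\<close>). This is where the smooth boundary enters: the Neumann
  datum is a derivative of \<open>u\<close> within the closed domain, and it determines the derivative of \<open>u'\<close>
  because the directions pointing into the domain fill an open half space and hence span.

  In the residual (lemma \<open>weighted_residual_bound\<close>) the weights turn the sum over each of the three
  groups of points into an average. The interior and Neumann groups contribute the square of the
  consistency bound each, which gives the factor \<open>sqrt 2\<close>. The Dirichlet group carries in addition
  the reciprocal of the average node distance, but its consistency error is an interpolation error,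
  two powers of \<open>h\<close> smaller. One power pays for the weight, since the average node distance is
  bounded below through the node quality. The other is absorbed by \<open>h \<le> sqrt (C / C\<^sub>0)\<close>, which the
  second consistency inequality forces unless the seminorm vanishes, when both errors vanish with it
  (lemma \<open>dirichlet_error_scaling\<close>).
\<close>

section \<open>Derivatives on the closed domain\<close>

lemma frechet_derivative_eq_grad:
  fixes f :: "real^'d::finite \<Rightarrow> real"
  assumes "f differentiable (at x)"
  shows "frechet_derivative f (at x) v = grad f x \<bullet> v"
proof -
  interpret linear "frechet_derivative f (at x)"
    using assms by (rule linear_frechet_derivative)
  have "frechet_derivative f (at x) v
      = frechet_derivative f (at x) (\<Sum>i\<in>UNIV. v $ i *\<^sub>R axis i 1)"
    by (subst basis_expansion[of v, symmetric]) (simp add: scalar_mult_eq_scaleR)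
  also have "\<dots> = (\<Sum>i\<in>UNIV. v $ i * frechet_derivative f (at x) (axis i 1))"
    by (simp add: sum scale)
  also have "\<dots> = grad f x \<bullet> v"
    by (simp add: grad_def partial_deriv_def inner_vec_def mult.commute)
  finally show ?thesis .
qed

lemma partial_deriv_cong_open:
  assumes "open S" "x \<in> S" "\<And>z. z \<in> S \<Longrightarrow> f z = g z"
  shows "partial_deriv i f x = partial_deriv i g x"
proof -
  have "(f has_derivative f') (at x) \<longleftrightarrow> (g has_derivative f') (at x)" for f'
    using assms has_derivative_transform_within_open[of f f' x UNIV S g]
      has_derivative_transform_within_open[of g f' x UNIV S f] by auto
  then show ?thesis
    by (simp add: partial_deriv_def frechet_derivative_def)
qed

lemma laplacian_cong_open:
  assumes "open S" "x \<in> S" "\<And>z. z \<in> S \<Longrightarrow> f z = g z"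
  shows "laplacian f x = laplacian g x"
  unfolding laplacian_def
  by (intro sum.cong refl partial_deriv_cong_open[OF assms(1,2)])
     (rule partial_deriv_cong_open[OF assms(1)]; use assms in auto)

lemma smooth_on_open_differentiable:
  assumes "smooth_on_open S f" "x \<in> S"
  shows "f differentiable (at x)"
  using assms unfolding smooth_on_open_def by (metis partial_derivs.simps(1))

text \<open>A defining function \<open>r\<close> is at most \<open>0\<close> at a boundary point, since it is negative on \<open>\<Omega>\<close>, and it
  strictly decreases along \<open>v\<close>; so it stays negative on a short segment. These segments are what
  makes derivatives within the closed domain unique.\<close>

lemma points_inward:
  assumes r: "local_defining_function \<Omega> U r" and y: "y \<in> U" "y \<in> frontier \<Omega>"
    and v: "grad r y \<bullet> v < 0"
  shows "\<exists>d>0. \<forall>t. 0 < t \<longrightarrow> t < d \<longrightarrow> y + t *\<^sub>R v \<in> \<Omega>"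
proof -
  have U: "open U" and neg: "\<And>x. x \<in> U \<Longrightarrow> x \<in> \<Omega> \<longleftrightarrow> r x < 0"
    and diff: "r differentiable (at y)"
    using r y smooth_on_open_differentiable
    unfolding local_defining_function_def smooth_on_open_def by blast+
  have "r y \<le> 0"
  proof (rule ccontr)
    assume "\<not> r y \<le> 0"
    moreover have "isCont r y"
      using diff differentiable_imp_continuous_within by blast
    ultimately have "eventually (\<lambda>x. r x > 0) (nhds y)"
      by (intro order_tendstoD(1)[of r "r y"]) (auto simp: isCont_def tendsto_at_iff_tendsto_nhds)
    moreover have "eventually (\<lambda>x. x \<in> U) (nhds y)"
      using U y eventually_nhds by blast
    ultimately have "eventually (\<lambda>x. x \<in> U \<and> r x > 0) (nhds y)"
      by (simp add: eventually_conj)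
    then obtain V where V: "open V" "y \<in> V" "\<And>x. x \<in> V \<Longrightarrow> x \<in> U \<and> r x > 0"
      unfolding eventually_nhds by blast
    have "y \<in> closure \<Omega>" using y by (simp add: frontier_def)
    then have "V \<inter> \<Omega> \<noteq> {}"
      using open_Int_closure_eq_empty[OF V(1), of \<Omega>] V(2) by blast
    then obtain x where "x \<in> \<Omega>" "x \<in> V" by blast
    then have "r x < 0" "0 < r x" using V(3)[of x] neg[of x] by auto
    then show False by simp
  qed
  have "((\<lambda>t. r (y + t *\<^sub>R v)) has_derivative (\<lambda>t. frechet_derivative r (at y) (t *\<^sub>R v))) (at 0)"
  proof -
    have "(r has_derivative frechet_derivative r (at y)) (at (y + 0 *\<^sub>R v))"
      using diff by (simp add: frechet_derivative_works[symmetric])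
    then show ?thesis
      by (rule has_derivative_compose[rotated]) (auto intro!: derivative_eq_intros)
  qed
  then have "DERIV (\<lambda>t. r (y + t *\<^sub>R v)) 0 :> grad r y \<bullet> v"
    by (simp add: frechet_derivative_eq_grad[OF diff] has_field_derivative_def mult_commute_abs)
  from DERIV_neg_dec_right[OF this v]
  obtain d1 where d1: "d1 > 0" "\<And>t. 0 < t \<Longrightarrow> t < d1 \<Longrightarrow> r (y + t *\<^sub>R v) < r y"
    by auto
  have "isCont (\<lambda>t. y + t *\<^sub>R v) 0" by (intro continuous_intros)
  then have "((\<lambda>t. y + t *\<^sub>R v) \<longlongrightarrow> y) (at 0)" by (simp add: isCont_def)
  then have "eventually (\<lambda>t. y + t *\<^sub>R v \<in> U) (at 0)"
    using U y(1) by (rule topological_tendstoD)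
  then obtain d2 where d2: "d2 > 0" "\<And>t. t \<noteq> 0 \<Longrightarrow> \<bar>t\<bar> < d2 \<Longrightarrow> y + t *\<^sub>R v \<in> U"
    unfolding eventually_at by (auto simp: dist_norm)
  show ?thesis
  proof (intro exI[of _ "min d1 d2"] conjI allI impI)
    show "0 < min d1 d2" using d1 d2 by simp
    fix t :: real assume "0 < t" "t < min d1 d2"
    then have "y + t *\<^sub>R v \<in> U" "r (y + t *\<^sub>R v) < 0"
      using d1(2)[of t] d2(2)[of t] \<open>r y \<le> 0\<close> by auto
    then show "y + t *\<^sub>R v \<in> \<Omega>" using neg by blast
  qed
qed

lemma has_derivative_unique_along:
  fixes f :: "'a::real_normed_vector \<Rightarrow> 'b::real_normed_vector"
  assumes F: "(f has_derivative F) (at y within S)" and G: "(f has_derivative G) (at y within S)"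
    and d: "0 < d" and S: "\<And>t. 0 \<le> t \<Longrightarrow> t \<le> d \<Longrightarrow> y + t *\<^sub>R v \<in> S"
  shows "F v = G v"
proof -
  have *: "((\<lambda>t. f (y + t *\<^sub>R v)) has_vector_derivative H v) (at 0 within cbox 0 d)"
    if H: "(f has_derivative H) (at y within S)" for H
  proof -
    have "((\<lambda>t. y + t *\<^sub>R v) has_derivative (\<lambda>t. t *\<^sub>R v)) (at 0 within cbox 0 d)"
      by (auto intro!: derivative_eq_intros)
    moreover have "(f has_derivative H) (at (y + 0 *\<^sub>R v) within (\<lambda>t. y + t *\<^sub>R v) ` cbox 0 d)"
      using H S by (auto intro: has_derivative_subset)
    ultimately have "((\<lambda>t. f (y + t *\<^sub>R v)) has_derivative (\<lambda>t. H (t *\<^sub>R v))) (at 0 within cbox 0 d)"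
      by (rule has_derivative_in_compose)
    then show ?thesis
      using has_derivative_linear[OF H] by (simp add: has_vector_derivative_def linear_cmul)
  qed
  show ?thesis
    using vector_derivative_unique_within_closed_interval[OF d _ *[OF F] *[OF G]] d by simp
qed

text \<open>The general uniqueness criteria ask for points of the set along every coordinate axis, which fails
  for a strictly convex domain in tangential directions. Here the half space of inward directions
  replaces the axes.\<close>

lemma has_derivative_unique_at_smooth_boundary:
  fixes f :: "real^'a::finite \<Rightarrow> 'b::real_normed_vector"
  assumes \<Omega>: "smooth_boundary \<Omega>" and y: "y \<in> frontier \<Omega>"
    and F: "(f has_derivative F) (at y within closure \<Omega>)"
    and G: "(f has_derivative G) (at y within closure \<Omega>)"
  shows "F = G"
proof
  fix w
  obtain U r where U: "y \<in> U" and r: "local_defining_function \<Omega> U r"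
    using \<Omega> y unfolding smooth_boundary_def by blast
  have inward: "F v = G v" if v: "grad r y \<bullet> v < 0" for v
  proof -
    obtain d where d: "d > 0" "\<And>t. 0 < t \<Longrightarrow> t < d \<Longrightarrow> y + t *\<^sub>R v \<in> \<Omega>"
      using points_inward[OF r U y v] by blast
    have seg: "y + t *\<^sub>R v \<in> closure \<Omega>" if "0 \<le> t" "t \<le> d / 2" for t
    proof (cases "t = 0")
      case True
      then show ?thesis using y by (simp add: frontier_def)
    next
      case False
      then have "y + t *\<^sub>R v \<in> \<Omega>" using that d(1) by (intro d(2)) auto
      then show ?thesis using closure_subset by blast
    qed
    show ?thesis
      by (rule has_derivative_unique_along[OF F G half_gt_zero[OF d(1)] seg])
  qed
  define g where "g = grad r y"
  have g: "g \<bullet> g > 0"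
    using r U by (simp add: g_def local_defining_function_def)
  \<comment> \<open>\<open>s\<close> is so large that \<open>w\<close> becomes the difference of the inward vectors \<open>w - s g\<close> and \<open>- s g\<close>.\<close>
  define s where "s = (\<bar>g \<bullet> w\<bar> + 1) / (g \<bullet> g)"
  have "s > 0" using g by (simp add: s_def add_nonneg_pos)
  have sg: "s * (g \<bullet> g) = \<bar>g \<bullet> w\<bar> + 1" using g by (simp add: s_def)
  have "g \<bullet> (- s *\<^sub>R g) < 0" using \<open>s > 0\<close> g by (simp add: mult_pos_pos)
  then have eq1: "F (- s *\<^sub>R g) = G (- s *\<^sub>R g)" by (intro inward) (simp only: g_def)
  have "g \<bullet> (w + - s *\<^sub>R g) < 0" using sg by (simp add: inner_diff_right)
  then have eq2: "F (w + - s *\<^sub>R g) = G (w + - s *\<^sub>R g)" by (intro inward) (simp only: g_def)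
  have "H w = H (w + - s *\<^sub>R g) - H (- s *\<^sub>R g)" if "linear H" for H :: "real^'a \<Rightarrow> 'b"
    by (simp only: linear_add[OF that] add_diff_cancel_right')
  from this[OF has_derivative_linear[OF F]] this[OF has_derivative_linear[OF G]]
  show "F w = G w" by (simp only: eq1 eq2)
qed

lemma pde_operator_extension_eq_data:
  assumes problem: "problem_domain \<Omega> \<Omega>\<^sub>0 \<Omega>\<^sub>1 \<nu>"
    and sol: "smooth_solution \<Omega> \<Omega>\<^sub>0 \<Omega>\<^sub>1 \<nu> f\<^sub>2 f\<^sub>0 f\<^sub>1 u"
    and ext: "smooth_extension \<Omega> \<Omega>' u u'"
    and y: "y \<in> \<Omega> \<union> \<Omega>\<^sub>0 \<union> \<Omega>\<^sub>1"
  shows "pde_operator \<Omega> \<Omega>\<^sub>0 \<nu> u' y = pde_data \<Omega> \<Omega>\<^sub>0 f\<^sub>2 f\<^sub>0 f\<^sub>1 y"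
proof -
  have op: "open \<Omega>" and sb: "smooth_boundary \<Omega>"
    and fr: "\<Omega>\<^sub>0 \<subseteq> frontier \<Omega>" "\<Omega>\<^sub>1 \<subseteq> frontier \<Omega>"
    using problem by (auto simp: problem_domain_def)
  have eq: "\<And>x. x \<in> closure \<Omega> \<Longrightarrow> u' x = u x" and sm: "smooth_on_open \<Omega>' u'"
    and sub: "closure \<Omega> \<subseteq> \<Omega>'"
    using ext by (auto simp: smooth_extension_def)
  consider (interior) "y \<in> \<Omega>" | (dirichlet) "y \<notin> \<Omega>" "y \<in> \<Omega>\<^sub>0"
    | (neumann) "y \<notin> \<Omega>" "y \<notin> \<Omega>\<^sub>0" "y \<in> \<Omega>\<^sub>1" using y by blast
  then show ?thesis
  proof cases
    case interior
    then have "laplacian u' y = laplacian u y"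
      using op eq closure_subset by (intro laplacian_cong_open[of \<Omega>]) auto
    with interior show ?thesis
      using sol by (simp add: pde_operator_def pde_data_def smooth_solution_def)
  next
    case dirichlet
    then have "y \<in> closure \<Omega>" using fr by (auto simp: frontier_def)
    with dirichlet show ?thesis
      using sol eq by (simp add: pde_operator_def pde_data_def smooth_solution_def)
  next
    case neumann
    then have yf: "y \<in> frontier \<Omega>" using fr by auto
    then have yc: "y \<in> closure \<Omega>" by (auto simp: frontier_def)
    have diff: "u' differentiable (at y)"
      using sm sub yc smooth_on_open_differentiable by blast
    then have "(u' has_derivative frechet_derivative u' (at y)) (at y within closure \<Omega>)"
      unfolding frechet_derivative_works by (rule has_derivative_at_withinI)
    then have d: "(u has_derivative frechet_derivative u' (at y)) (at y within closure \<Omega>)"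
      by (rule has_derivative_transform[OF yc eq[symmetric], rotated])
    then have "u differentiable (at y within closure \<Omega>)"
      unfolding differentiable_def by blast
    then have "(u has_derivative frechet_derivative u (at y within closure \<Omega>)) (at y within closure \<Omega>)"
      by (simp only: frechet_derivative_works[symmetric])
    then have du: "frechet_derivative u' (at y) = frechet_derivative u (at y within closure \<Omega>)"
      by (rule has_derivative_unique_at_smooth_boundary[OF sb yf d])
    have "frechet_derivative u (at y within closure \<Omega>) (\<nu> y) = f\<^sub>1 y"
      using sol neumann by (simp add: smooth_solution_def)
    then have "grad u' y \<bullet> \<nu> y = f\<^sub>1 y"
      by (simp only: frechet_derivative_eq_grad[OF diff, symmetric] du)
    with neumann show ?thesis
      by (simp add: pde_operator_def pde_data_def)
  qed
qed

section \<open>Least squares and discrete norms\<close>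

lemma pseudoinverse_mult_left:
  fixes A :: "real^'N::finite^'M::finite"
  assumes "rank A = CARD('N)"
  shows "pseudoinverse A ** A = mat 1"
proof -
  have inj: "inj ((*v) A)" using assms full_rank_injective by blast
  have "x = 0" if x: "(transpose A ** A) *v x = 0" for x
  proof -
    have "(A *v x) \<bullet> (A *v x) = x \<bullet> ((transpose A ** A) *v x)"
      by (simp add: dot_lmul_matrix[symmetric] matrix_vector_mul_assoc[symmetric] inner_commute)
    then have "A *v x = 0" using x by simp
    then show "x = 0" using inj injD[of "(*v) A" x 0] by simp
  qed
  then have "\<exists>B. B ** (transpose A ** A) = mat 1"
    using matrix_left_invertible_ker by blast
  then have "invertible (transpose A ** A)"
    using invertible_left_inverse by blast
  then have "matrix_inv (transpose A ** A) ** (transpose A ** A) = mat 1"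
    unfolding matrix_inv_def invertible_def by (metis (mono_tags, lifting) someI_ex)
  then show ?thesis by (simp add: pseudoinverse_def matrix_mul_assoc)
qed

lemma norm_matrix_vector_le:
  fixes A :: "real^'N::finite^'M::finite"
  shows "norm (A *v x) \<le> matrix_norm2 A * norm x"
  by (rule onorm[OF matrix_vector_mul_bounded_linear])

lemma matrix_norm2_nonneg:
  fixes A :: "real^'N::finite^'M::finite"
  shows "0 \<le> matrix_norm2 A"
  by (rule onorm_pos_le[OF matrix_vector_mul_bounded_linear])

lemma l2_norm_eq_norm:
  "l2_norm (e :: real^'M::finite) = norm e / sqrt (real CARD('M))"
  by (simp add: l2_norm_def norm_vec_def L2_set_def real_sqrt_mult real_sqrt_divide)

lemma l2_norm_triangle: "l2_norm (a + b) \<le> l2_norm a + l2_norm b"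
  unfolding l2_norm_eq_norm add_divide_distrib[symmetric]
  by (intro divide_right_mono norm_triangle_ineq) simp

lemma l2_norm_le_componentwise:
  fixes e :: "real^'M::finite"
  assumes "\<And>k. \<bar>e $ k\<bar> \<le> B"
  shows "l2_norm e \<le> B"
proof -
  have "0 \<le> B" using assms[of undefined] by linarith
  have "(\<Sum>k\<in>UNIV. (e $ k)\<^sup>2) \<le> (\<Sum>k\<in>(UNIV :: 'M set). B\<^sup>2)"
    using assms \<open>0 \<le> B\<close> by (intro sum_mono) (simp add: abs_le_square_iff[symmetric])
  then show ?thesis
    unfolding l2_norm_def using \<open>0 \<le> B\<close> by (intro real_le_lsqrt) (auto simp: field_simps)
qed

text \<open>For an infinite \<open>K\<close> the cardinality is \<open>0\<close> and the sum vanishes as well; the empty case, that of a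
  group of evaluation points that does not occur, matters below.\<close>

lemma sum_squares_scaled_by_card_le:
  fixes r :: "'k \<Rightarrow> real"
  assumes "\<And>k. k \<in> K \<Longrightarrow> \<bar>r k\<bar> \<le> B / sqrt (real (card K))"
  shows "(\<Sum>k\<in>K. (r k)\<^sup>2) \<le> B\<^sup>2"
proof (cases "finite K \<and> K \<noteq> {}")
  case True
  have "(\<Sum>k\<in>K. (r k)\<^sup>2) \<le> (\<Sum>k\<in>K. (B / sqrt (real (card K)))\<^sup>2)"
    using assms by (intro sum_mono) (metis abs_ge_zero power2_abs power_mono)
  also have "\<dots> = B\<^sup>2" using True by (simp add: power_divide)
  finally show ?thesis .
qed auto

lemma least_squares_error_bound:
  fixes E :: "real^'N::finite^'M::finite" and A :: "real^'N^'M"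
  assumes rank: "rank A = CARD('N)"
    and e: "l2_norm (v - E *v w) \<le> \<epsilon>" and r: "norm (A *v w - b) \<le> \<delta>"
  shows "l2_norm (v - E *v (pseudoinverse A *v b))
      \<le> 1 / sqrt (real CARD('M)) * matrix_norm2 E * matrix_norm2 (pseudoinverse A) * \<delta> + \<epsilon>"
proof -
  have "w = pseudoinverse A *v (A *v w)"
    by (simp add: matrix_vector_mul_assoc pseudoinverse_mult_left[OF rank])
  then have eq: "v - E *v (pseudoinverse A *v b) = (v - E *v w) + E *v (pseudoinverse A *v (A *v w - b))"
    by (simp add: matrix_vector_mult_diff_distrib)
  have split: "l2_norm (v - E *v (pseudoinverse A *v b))
      \<le> \<epsilon> + l2_norm (E *v (pseudoinverse A *v (A *v w - b)))"
    unfolding eq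
    using l2_norm_triangle[of "v - E *v w" "E *v (pseudoinverse A *v (A *v w - b))"] e by linarith
  have "norm (E *v (pseudoinverse A *v (A *v w - b)))
      \<le> matrix_norm2 E * norm (pseudoinverse A *v (A *v w - b))"
    by (rule norm_matrix_vector_le)
  moreover have "\<dots> \<le> matrix_norm2 E * (matrix_norm2 (pseudoinverse A) * \<delta>)"
  proof (intro mult_left_mono matrix_norm2_nonneg)
    have "norm (pseudoinverse A *v (A *v w - b)) \<le> matrix_norm2 (pseudoinverse A) * norm (A *v w - b)"
      by (rule norm_matrix_vector_le)
    also have "\<dots> \<le> matrix_norm2 (pseudoinverse A) * \<delta>"
      by (intro mult_left_mono r matrix_norm2_nonneg)
    finally show "norm (pseudoinverse A *v (A *v w - b)) \<le> matrix_norm2 (pseudoinverse A) * \<delta>" .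
  qed
  ultimately have bound: "norm (E *v (pseudoinverse A *v (A *v w - b))) / sqrt (real CARD('M))
      \<le> (matrix_norm2 E * (matrix_norm2 (pseudoinverse A) * \<delta>)) / sqrt (real CARD('M))"
    by (intro divide_right_mono) auto
  then show ?thesis
    using split by (simp add: l2_norm_eq_norm algebra_simps)
qed

section \<open>Node distances\<close>

text \<open>A nonempty open set is not covered by finitely many nodes. Positivity is needed because for
  \<open>p = 0\<close> the estimates contain the reciprocal of \<open>h\<close>.\<close>

lemma fill_distance_pos:
  fixes X :: "'N::finite \<Rightarrow> real^'d::finite"
  assumes "open \<Omega>" "bounded \<Omega>" "\<Omega> \<noteq> {}"
  shows "0 < fill_distance \<Omega> X"
proof -
  have "interior (range X) = {}" by (simp add: empty_interior_finite)
  then have "\<not> \<Omega> \<subseteq> range X" using assms interior_maximal by blast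
  then obtain x where x: "x \<in> \<Omega>" "x \<notin> range X" by blast
  then have "0 < Min (range (\<lambda>j. norm (x - X j)))" by auto
  also have "\<dots> \<le> fill_distance \<Omega> X"
    unfolding fill_distance_def
  proof (rule cSUP_upper[OF x(1)])
    obtain B where B: "\<And>z. z \<in> \<Omega> \<Longrightarrow> norm z \<le> B" using assms bounded_iff by blast
    show "bdd_above ((\<lambda>x. Min (range (\<lambda>j. norm (x - X j)))) ` \<Omega>)"
    proof (rule bdd_aboveI2)
      fix z assume "z \<in> \<Omega>"
      have "Min (range (\<lambda>j. norm (z - X j))) \<le> norm (z - X undefined)" by (intro Min_le) auto
      also have "\<dots> \<le> B + norm (X undefined)"
        using B[OF \<open>z \<in> \<Omega>\<close>] norm_triangle_ineq4[of z "X undefined"] by linarith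
      finally show "Min (range (\<lambda>j. norm (z - X j))) \<le> B + norm (X undefined)" .
    qed
  qed
  finally show ?thesis .
qed

lemma ex_other_index:
  assumes "2 \<le> CARD('N::finite)"
  shows "\<exists>j. j \<noteq> (i :: 'N)"
proof (rule ccontr)
  assume "\<not> ?thesis"
  then have "(UNIV :: 'N set) = {i}" by auto
  then have "CARD('N) = card {i}" by (rule arg_cong)
  then show False using assms by simp
qed

lemma finite_node_distances: "finite {norm (X j - X k) | j k :: 'N::finite. j \<noteq> k}"
proof (rule finite_subset)
  show "{norm (X j - X k) | j k. j \<noteq> k} \<subseteq> (\<lambda>(j, k). norm (X j - X k)) ` UNIV" by auto
qed simp

lemma separation_distance_pos:
  fixes X :: "'N::finite \<Rightarrow> real^'d::finite"
  assumes N: "2 \<le> CARD('N)" and X: "inj X"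
  shows "0 < separation_distance X"
proof -
  have "{norm (X j - X k) | j k. j \<noteq> k} \<noteq> {}" using ex_other_index[OF N] by blast
  then have "0 < Min {norm (X j - X k) | j k. j \<noteq> k}"
    using finite_node_distances[of X] X by (auto simp: inj_eq)
  then show ?thesis by (simp add: separation_distance_def)
qed

lemma separation_distance_le_average:
  fixes X :: "'N::finite \<Rightarrow> real^'d::finite"
  assumes N: "2 \<le> CARD('N)"
  shows "2 * separation_distance X \<le> average_node_distance X"
proof -
  have "2 * separation_distance X \<le> Min {norm (X i - X j) | j. j \<noteq> i}" for i
  proof -
    have "Min {norm (X j - X k) | j k. j \<noteq> k} \<le> Min {norm (X i - X j) | j. j \<noteq> i}"
      using ex_other_index[OF N, of i] finite_node_distances[of X]
      by (intro Min_antimono) blast+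
    then show ?thesis by (simp add: separation_distance_def)
  qed
  then have "(\<Sum>i\<in>(UNIV :: 'N set). 2 * separation_distance X)
      \<le> (\<Sum>i\<in>UNIV. Min {norm (X i - X j) | j. j \<noteq> i})"
    by (intro sum_mono)
  then show ?thesis by (simp add: average_node_distance_def field_simps)
qed

text \<open>This converts the Dirichlet weight, scaled by the average node distance, into the fill distance in
  which the approximation estimates are expressed.\<close>

lemma fill_distance_le_quality_times_average:
  fixes X :: "'N::finite \<Rightarrow> real^'d::finite"
  assumes N: "2 \<le> CARD('N)" and X: "inj X" and "0 \<le> fill_distance \<Omega> X"
  shows "fill_distance \<Omega> X \<le> node_quality \<Omega> X * average_node_distance X"
proof -
  have s: "0 < separation_distance X" by (rule separation_distance_pos[OF N X])
  have "fill_distance \<Omega> X = node_quality \<Omega> X * separation_distance X"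
    using s by (simp add: node_quality_def)
  also have "\<dots> \<le> node_quality \<Omega> X * average_node_distance X"
    using separation_distance_le_average[OF N, of X] s assms(3)
    by (intro mult_left_mono) (auto simp: node_quality_def)
  finally show ?thesis .
qed

section \<open>The weighted residual\<close>

lemma sobolev_seminorm_nonneg:
  assumes "bdd_above (deriv_values k S f)" "S \<noteq> {}"
  shows "0 \<le> sobolev_seminorm k S f"
proof -
  obtain y where "y \<in> S" using assms by blast
  then have "\<bar>partial_derivs (replicate k undefined) f y\<bar> \<in> deriv_values k S f"
    unfolding deriv_values_def by (auto intro!: exI[of _ "replicate k undefined"])
  then have "\<bar>partial_derivs (replicate k undefined) f y\<bar> \<le> sobolev_seminorm k S f"
    unfolding sobolev_seminorm_def using assms(1) by (rule cSup_upper)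
  then show ?thesis by linarith
qed

text \<open>At a Dirichlet point the operator is evaluation, so the sharper interpolation estimate applies
  there instead of the consistency estimate.\<close>

lemma cardinal_pde_operator_dirichlet:
  assumes "y \<notin> \<Omega>" "y \<in> \<Omega>\<^sub>0"
  shows "cardinal_sum (pde_operator \<Omega> \<Omega>\<^sub>0 \<nu>) \<mu> X \<Gamma> \<rho> w y = cardinal_sum id \<mu> X \<Gamma> \<rho> w y"
  using assms by (simp add: cardinal_sum_def cardinal_def pde_operator_def)

text \<open>The bound \<open>a * B0\<close> on the Dirichlet errors is stated so that the factor \<open>1 / a\<close> in their weight
  cancels. The three groups give \<open>2 B\<^sup>2 + B0\<^sup>2\<close>, which is at most \<open>(sqrt 2 B + B0)\<^sup>2\<close>.\<close>

lemma weighted_residual_bound: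
  fixes Y :: "'M::finite \<Rightarrow> real^'d::finite" and r :: "real^'M"
  assumes Y: "range Y \<subseteq> \<Omega> \<union> \<Omega>\<^sub>0 \<union> \<Omega>\<^sub>1"
    and disj: "\<Omega> \<inter> \<Omega>\<^sub>0 = {}" "\<Omega> \<inter> \<Omega>\<^sub>1 = {}" "\<Omega>\<^sub>0 \<inter> \<Omega>\<^sub>1 = {}"
    and r: "\<And>k. r $ k = row_weight \<Omega> \<Omega>\<^sub>0 \<Omega>\<^sub>1 a Y (Y k) * \<tau> (Y k)"
    and a: "0 < a" and nonneg: "0 \<le> B" "0 \<le> B0"
    and \<tau>: "\<And>y. y \<in> \<Omega> \<union> \<Omega>\<^sub>0 \<union> \<Omega>\<^sub>1 \<Longrightarrow> \<bar>\<tau> y\<bar> \<le> B"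
    and \<tau>0: "\<And>y. y \<in> \<Omega>\<^sub>0 \<Longrightarrow> \<bar>\<tau> y\<bar> \<le> a * B0"
  shows "norm r \<le> sqrt 2 * B + B0"
proof -
  define K where "K S = {k. Y k \<in> S}" for S
  have sum: "(\<Sum>k\<in>K \<Omega>. (r $ k)\<^sup>2) \<le> B\<^sup>2" "(\<Sum>k\<in>K \<Omega>\<^sub>1. (r $ k)\<^sup>2) \<le> B\<^sup>2"
    "(\<Sum>k\<in>K \<Omega>\<^sub>0. (r $ k)\<^sup>2) \<le> B0\<^sup>2"
  proof (safe intro!: sum_squares_scaled_by_card_le)
    fix k
    show "\<bar>r $ k\<bar> \<le> B / sqrt (real (card (K \<Omega>)))" if "k \<in> K \<Omega>"
      using that \<tau>[of "Y k"] by (auto simp: K_def r row_weight_def abs_mult intro: divide_right_mono)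
    show "\<bar>r $ k\<bar> \<le> B / sqrt (real (card (K \<Omega>\<^sub>1)))" if "k \<in> K \<Omega>\<^sub>1"
    proof -
      have "Y k \<notin> \<Omega>" "Y k \<notin> \<Omega>\<^sub>0" using that disj by (auto simp: K_def)
      then show ?thesis
        using that \<tau>[of "Y k"] by (auto simp: K_def r row_weight_def abs_mult intro: divide_right_mono)
    qed
    show "\<bar>r $ k\<bar> \<le> B0 / sqrt (real (card (K \<Omega>\<^sub>0)))" if "k \<in> K \<Omega>\<^sub>0"
    proof -
      have "Y k \<notin> \<Omega>" "Y k \<in> \<Omega>\<^sub>0" using that disj by (auto simp: K_def)
      moreover have "\<bar>\<tau> (Y k)\<bar> / a \<le> B0"
        using \<tau>0[of "Y k"] that a by (simp add: K_def field_simps)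
      then have "\<bar>\<tau> (Y k)\<bar> / a / sqrt (real (card (K \<Omega>\<^sub>0))) \<le> B0 / sqrt (real (card (K \<Omega>\<^sub>0)))"
        by (rule divide_right_mono) simp
      ultimately show ?thesis
        using a by (simp add: K_def r row_weight_def abs_mult)
    qed
  qed
  have U: "UNIV = K \<Omega> \<union> K \<Omega>\<^sub>1 \<union> K \<Omega>\<^sub>0" using Y by (auto simp: K_def)
  have "(norm r)\<^sup>2 = (\<Sum>k\<in>UNIV. (r $ k)\<^sup>2)"
    by (simp add: norm_vec_def L2_set_def sum_nonneg)
  also have "\<dots> = (\<Sum>k\<in>K \<Omega>. (r $ k)\<^sup>2) + (\<Sum>k\<in>K \<Omega>\<^sub>1. (r $ k)\<^sup>2) + (\<Sum>k\<in>K \<Omega>\<^sub>0. (r $ k)\<^sup>2)"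
    unfolding U using disj by (subst sum.union_disjoint; (subst sum.union_disjoint)?; auto simp: K_def)
  also have "\<dots> \<le> 2 * B\<^sup>2 + B0\<^sup>2" using sum by linarith
  also have "\<dots> \<le> (sqrt 2 * B + B0)\<^sup>2"
    using nonneg by (simp add: power2_sum power_mult_distrib)
  finally show ?thesis
    using nonneg by (intro power2_le_imp_le[of "norm r"]) auto
qed

text \<open>Dropping the first two terms of the consistency inequality leaves
  \<open>C0 * h ^ (p + 1) \<le> C * h powi (p - 1)\<close> unless \<open>S = 0\<close>, that is \<open>h \<le> sqrt (C / C0)\<close>. Of the two surplus
  powers of \<open>h\<close>, one is bounded in this way and the other by \<open>q * a\<close>.\<close>

lemma dirichlet_error_scaling:
  fixes h :: real
  assumes pos: "0 < h" "0 < C2" "0 < C1" "0 < C0" "0 < C" "0 < CI" and S: "0 \<le> S" and q: "0 \<le> q"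
    and ha: "h \<le> q * a"
    and est: "(C2 * h powi (int p - 1) + C1 * h ^ p + C0 * h ^ (p + 1)) * S
        \<le> C * h powi (int p - 1) * S"
  shows "CI * h ^ (p + 1) * S \<le> a * (q * CI * sqrt (C / C0) * h powi (int p - 1) * S)"
proof (cases "S = 0")
  case False
  define m where "m = h powi (int p - 1)"
  have m: "0 < m" using pos by (simp add: m_def)
  have hp: "h ^ p = h * m"
    using pos by (simp add: m_def power_int_diff field_simps)
  have "C2 * m + C1 * h ^ p + C0 * h ^ (p + 1) \<le> C * m"
    using est False S unfolding m_def by simp
  moreover have "0 < C2 * m" "0 < C1 * h ^ p" using pos m by auto
  ultimately have "C0 * (h * h) * m \<le> C * m" by (simp add: hp mult_ac)
  then have "h\<^sup>2 \<le> C / C0" using m pos by (simp add: power2_eq_square field_simps)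
  then have "h \<le> sqrt (C / C0)" by (rule real_le_rsqrt)
  then have "h * h \<le> (q * a) * sqrt (C / C0)"
    using ha pos by (intro mult_mono) auto
  then have "(h * h) * (CI * m * S) \<le> ((q * a) * sqrt (C / C0)) * (CI * m * S)"
    using pos m S by (intro mult_right_mono) auto
  moreover have "CI * h ^ (p + 1) * S = (h * h) * (CI * m * S)" by (simp add: hp)
  ultimately show ?thesis unfolding m_def[symmetric] by (simp only: mult_ac)
qed simp

section \<open>The error estimate\<close>

theorem mainTheorem1:
  fixes \<Omega> \<Omega>\<^sub>0 \<Omega>\<^sub>1 \<Omega>' :: "(real^'d::finite) set"
    and \<nu> :: "real^'d \<Rightarrow> real^'d"
    and f\<^sub>2 f\<^sub>0 f\<^sub>1 u u' :: "real^'d \<Rightarrow> real"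
    and p :: nat
    and X :: "'N::finite \<Rightarrow> real^'d"
    and Y :: "'M::finite \<Rightarrow> real^'d"
    and \<Gamma> :: "'n::finite \<Rightarrow> 'N \<Rightarrow> 'N"
    and \<mu> :: "'m::finite \<Rightarrow> 'd \<Rightarrow> nat"
    and \<rho> :: "real^'d \<Rightarrow> 'N"
    and h C\<^sub>I C\<^sub>2 C\<^sub>1 C\<^sub>0 C C\<^sub>D C\<^sub>E :: real
  assumes dim: "CARD('d) = 2 \<or> CARD('d) = 3"
    and problem: "problem_domain \<Omega> \<Omega>\<^sub>0 \<Omega>\<^sub>1 \<nu>"
    and solution: "unique_smooth_solution \<Omega> \<Omega>\<^sub>0 \<Omega>\<^sub>1 \<nu> f\<^sub>2 f\<^sub>0 f\<^sub>1 u"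
    and extension: "smooth_extension \<Omega> \<Omega>' u u'"
    and seminorm_finite: "bdd_above (deriv_values (p + 1) \<Omega>' u')"
    and interpolation_points: "2 \<le> CARD('N)" "inj X" "range X \<subseteq> \<Omega>'"
    and evaluation_points: "range Y \<subseteq> \<Omega> \<union> \<Omega>\<^sub>0 \<union> \<Omega>\<^sub>1"
    and stencils: "is_stencil_map \<Gamma>"
    and monomials: "enumerates_monomials p \<mu>"
    and stencil_matrices: "\<And>i. invertible (stencil_matrix \<mu> X \<Gamma> i)"
    and closest: "closest_node X \<rho>"
    and h: "h = fill_distance \<Omega> X"
    and constants_pos: "C\<^sub>I > 0" "C\<^sub>2 > 0" "C\<^sub>1 > 0" "C\<^sub>0 > 0" "C > 0"
    and interpolation_estimate:
      "\<And>y. y \<in> closure \<Omega> \<Longrightarrow>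
         \<bar>u' y - cardinal_sum id \<mu> X \<Gamma> \<rho> u' y\<bar>
           \<le> C\<^sub>I * h ^ (p + 1) * sobolev_seminorm (p + 1) \<Omega>' u'"
    and consistency_estimate:
      "\<And>y. y \<in> \<Omega> \<union> \<Omega>\<^sub>0 \<union> \<Omega>\<^sub>1 \<Longrightarrow>
         \<bar>pde_operator \<Omega> \<Omega>\<^sub>0 \<nu> u' y - cardinal_sum (pde_operator \<Omega> \<Omega>\<^sub>0 \<nu>) \<mu> X \<Gamma> \<rho> u' y\<bar>
           \<le> (C\<^sub>2 * h powi (int p - 1) + C\<^sub>1 * h ^ p + C\<^sub>0 * h ^ (p + 1))
              * sobolev_seminorm (p + 1) \<Omega>' u'"
      "(C\<^sub>2 * h powi (int p - 1) + C\<^sub>1 * h ^ p + C\<^sub>0 * h ^ (p + 1)) * sobolev_seminorm (p + 1) \<Omega>' u'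
         \<le> C * h powi (int p - 1) * sobolev_seminorm (p + 1) \<Omega>' u'"
    and C\<^sub>D: "C\<^sub>D = consistency_constant (node_quality \<Omega> X) C\<^sub>I C\<^sub>0 C"
    and C\<^sub>E: "C\<^sub>E = C\<^sub>I"
    and full_column_rank: "rank (pde_matrix \<Omega> \<Omega>\<^sub>0 \<Omega>\<^sub>1 \<nu> \<mu> X \<Gamma> \<rho> Y) = CARD('N)"
  shows
    "l2_norm ((\<chi> k. u (Y k))
        - evaluation_matrix \<mu> X \<Gamma> \<rho> Y
            *v (pseudoinverse (pde_matrix \<Omega> \<Omega>\<^sub>0 \<Omega>\<^sub>1 \<nu> \<mu> X \<Gamma> \<rho> Y)
                  *v pde_rhs \<Omega> \<Omega>\<^sub>0 \<Omega>\<^sub>1 f\<^sub>2 f\<^sub>0 f\<^sub>1 X Y))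
      \<le> 1 / sqrt (real CARD('M))
          * matrix_norm2 (evaluation_matrix \<mu> X \<Gamma> \<rho> Y)
          * matrix_norm2 (pseudoinverse (pde_matrix \<Omega> \<Omega>\<^sub>0 \<Omega>\<^sub>1 \<nu> \<mu> X \<Gamma> \<rho> Y))
          * C\<^sub>D * h powi (int p - 1) * sobolev_seminorm (p + 1) \<Omega>' u'
        + C\<^sub>E * h ^ (p + 1) * sobolev_seminorm (p + 1) \<Omega>' u'"
proof -
  define S where "S = sobolev_seminorm (p + 1) \<Omega>' u'"
  define a where "a = average_node_distance X"
  define q where "q = node_quality \<Omega> X"
  define m where "m = h powi (int p - 1)"
  define \<tau> where
    "\<tau> y = cardinal_sum (pde_operator \<Omega> \<Omega>\<^sub>0 \<nu>) \<mu> X \<Gamma> \<rho> u' y - pde_data \<Omega> \<Omega>\<^sub>0 f\<^sub>2 f\<^sub>0 f\<^sub>1 y" for y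
  define w :: "real^'N" where "w = (\<chi> i. u' (X i))"
  let ?E = "evaluation_matrix \<mu> X \<Gamma> \<rho> Y" and ?A = "pde_matrix \<Omega> \<Omega>\<^sub>0 \<Omega>\<^sub>1 \<nu> \<mu> X \<Gamma> \<rho> Y"
    and ?b = "pde_rhs \<Omega> \<Omega>\<^sub>0 \<Omega>\<^sub>1 f\<^sub>2 f\<^sub>0 f\<^sub>1 X Y"

  have op: "open \<Omega>" and bd: "bounded \<Omega>"
    and fr: "\<Omega>\<^sub>0 \<subseteq> frontier \<Omega>" "\<Omega>\<^sub>1 \<subseteq> frontier \<Omega>" and disj01: "\<Omega>\<^sub>0 \<inter> \<Omega>\<^sub>1 = {}"
    using problem by (auto simp: problem_domain_def)
  have disj: "\<Omega> \<inter> \<Omega>\<^sub>0 = {}" "\<Omega> \<inter> \<Omega>\<^sub>1 = {}"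
    using fr op by (auto simp: frontier_def interior_open)
  have cl: "\<Omega> \<union> \<Omega>\<^sub>0 \<union> \<Omega>\<^sub>1 \<subseteq> closure \<Omega>"
    using fr closure_subset by (auto simp: frontier_def)
  have Yc: "Y k \<in> closure \<Omega>" for k using evaluation_points cl by blast
  then have "\<Omega> \<noteq> {}" by force
  then have hpos: "0 < h" using h fill_distance_pos[OF op bd] by simp
  then have m: "0 < m" by (simp add: m_def)
  have S: "0 \<le> S"
    unfolding S_def using seminorm_finite interpolation_points
    by (intro sobolev_seminorm_nonneg) auto
  have spos: "0 < separation_distance X"
    using separation_distance_pos[OF interpolation_points(1,2)] .
  then have a: "0 < a"
    using separation_distance_le_average[OF interpolation_points(1), of X] by (simp add: a_def)
  have q: "0 \<le> q" using hpos spos h by (simp add: q_def node_quality_def)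
  have ha: "h \<le> q * a"
    using fill_distance_le_quality_times_average[OF interpolation_points(1,2), of \<Omega>] hpos h
    by (simp add: q_def a_def)

  have data: "pde_operator \<Omega> \<Omega>\<^sub>0 \<nu> u' y = pde_data \<Omega> \<Omega>\<^sub>0 f\<^sub>2 f\<^sub>0 f\<^sub>1 y" if "y \<in> \<Omega> \<union> \<Omega>\<^sub>0 \<union> \<Omega>\<^sub>1" for y
    using pde_operator_extension_eq_data[OF problem _ extension that] solution
    unfolding unique_smooth_solution_def by blast
  have tau: "\<bar>\<tau> y\<bar> \<le> C * m * S" if "y \<in> \<Omega> \<union> \<Omega>\<^sub>0 \<union> \<Omega>\<^sub>1" for y
    using order_trans[OF consistency_estimate(1)[OF that] consistency_estimate(2)] data[OF that]
    by (simp add: \<tau>_def m_def S_def abs_minus_commute)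
  have tau0: "\<bar>\<tau> y\<bar> \<le> a * (q * C\<^sub>I * sqrt (C / C\<^sub>0) * m * S)" if y: "y \<in> \<Omega>\<^sub>0" for y
  proof -
    have "y \<notin> \<Omega>" using y disj by blast
    then have "\<bar>\<tau> y\<bar> = \<bar>u' y - cardinal_sum id \<mu> X \<Gamma> \<rho> u' y\<bar>"
      using data[of y] y
      by (simp add: \<tau>_def cardinal_pde_operator_dirichlet pde_operator_def abs_minus_commute)
    also have "\<dots> \<le> C\<^sub>I * h ^ (p + 1) * S"
      unfolding S_def using y cl by (intro interpolation_estimate) blast
    also have "\<dots> \<le> a * (q * C\<^sub>I * sqrt (C / C\<^sub>0) * m * S)"
      unfolding m_def
      by (rule dirichlet_error_scaling[of h C\<^sub>2 C\<^sub>1])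
         (use hpos constants_pos S q ha consistency_estimate(2) in \<open>simp_all add: S_def\<close>)
    finally show ?thesis .
  qed

  have row: "(?A *v w - ?b) $ k = row_weight \<Omega> \<Omega>\<^sub>0 \<Omega>\<^sub>1 a Y (Y k) * \<tau> (Y k)" for k
    by (simp add: pde_matrix_def pde_rhs_def matrix_vector_mult_def w_def \<tau>_def a_def
        cardinal_sum_def sum_distrib_left right_diff_distrib mult_ac)
  have "norm (?A *v w - ?b) \<le> sqrt 2 * (C * m * S) + q * C\<^sub>I * sqrt (C / C\<^sub>0) * m * S"
    using constants_pos q m S
    by (intro weighted_residual_bound[OF evaluation_points disj disj01 row a _ _ tau tau0]) auto
  also have "\<dots> = C\<^sub>D * m * S"
    by (simp add: C\<^sub>D consistency_constant_def q_def algebra_simps)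
  finally have residual: "norm (?A *v w - ?b) \<le> C\<^sub>D * m * S" .

  have "((\<chi> k. u (Y k)) - ?E *v w) $ k = u' (Y k) - cardinal_sum id \<mu> X \<Gamma> \<rho> u' (Y k)" for k
    using extension Yc[of k]
    by (simp add: evaluation_matrix_def matrix_vector_mult_def w_def cardinal_sum_def
        smooth_extension_def mult_ac)
  then have "l2_norm ((\<chi> k. u (Y k)) - ?E *v w) \<le> C\<^sub>E * h ^ (p + 1) * S"
    unfolding C\<^sub>E S_def
    by (intro l2_norm_le_componentwise) (simp only:, intro interpolation_estimate Yc)
  from least_squares_error_bound[OF full_column_rank this residual]
  show ?thesis
    unfolding S_def m_def by (simp only: mult.assoc)
qed

end
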